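(* For every integer $r\ge 2$ and real $x\ge 2$, $$ \sum_{n\le x}\tau(n)^{r}=C_{r}\,x(\log x)^{2^{r}-1}+O\big(x(\log x)^{2^{r}-2}\big), $$ where $$ C_{r}=\frac{1}{(2^{r}-1)!}\prod_{p}\left(\left(1-\frac{1}{p}\right)^{2^{r}}\left(\sum_{\alpha\ge 0}\frac{(\alpha+1)^{r}}{p^{\alpha}}\right)\right), $$ the product being over all primes $p$. The implied constant may depend on $r$ but not on $x$.
   Context: $\tau(n)$ denotes the number of positive divisors of the positive integer $n$. Sums over $n\le x$ are over positive integers $n\le x$. *)

theory Defs
  imports "HOL-Analysis.Analysis" "HOL-Computational_Algebra.Primes"
begin

definition divisor_tau :: "nat \<Rightarrow> nat" where
  "divisor_tau n = card {d. d dvd n}"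

definition euler_factor :: "nat \<Rightarrow> nat \<Rightarrow> real" where
  "euler_factor r p = (1 - 1 / real p) ^ (2 ^ r) * (\<Sum>\<alpha>. (real \<alpha> + 1) ^ r / real p ^ \<alpha>)"

text \<open>The product over the primes is indexed by all naturals in increasing order, with
  factor 1 at the non-primes.\<close>

definition prime_part :: "(nat \<Rightarrow> real) \<Rightarrow> nat \<Rightarrow> real" where
  "prime_part f p = (if prime p then f p else 1)"

definition C_const :: "nat \<Rightarrow> real" where
  "C_const r = 1 / fact (2 ^ r - 1) * prodinf (prime_part (euler_factor r))"

end

(* Put k = 2^r. At each prime the series sum (a+1)^r X^a equals (1 - X)^(-k) times a series
   1 + 0 X + O(X^2), so tau^r is the k-fold Dirichlet convolution of 1 with itself, convolved with a
   multiplicative g that vanishes at primes. Its Dirichlet series converges absolutely for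
   Re s > 1/2, and its value at 1 is the Euler product G in C_r. Hence 1 * g has summatory function
   G x + O(x^(3/4)), the next convolution with 1 gives G x log x + O(x), and each further one,
   replacing S(x) by the sum of S(x/e) over e <= x, raises the power of the logarithm by one in both
   terms and divides the main term by the new exponent. *)

theory Submission
  imports Defs
begin

subsection \<open>Multiplicative functions\<close>

text \<open>A multiplicative function is handled through its local weights \<open>w p a\<close>, so
  convolution with 1 becomes the passage to partial sums in the exponent, and the k-fold
  deconvolution of tau^r becomes k backward differences of (a + 1)^r. No inverse under convolution
  has to be constructed. The value k = 2^r is forced: (1 - X)^k (1 + 2^r X + ...) has linear
  coefficient 2^r - k. Once it vanishes, each Euler factor of g is 1 + O(p^(-2s)), and convergence
  needs only 2s > 1. What the induction requires is absolute convergence at some s < 1. The first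
  convolution with 1 then has error O(x^s), and the sum of (x/e)^s over e <= x is O(x), so the
  second convolution raises the power of the logarithm in the main term but not in the error. This
  one-step lead yields the exponent 2^r - 2 in the error; each later convolution costs a full
  logarithm in both terms.\<close>

definition mult_ext :: "(nat \<Rightarrow> nat \<Rightarrow> real) \<Rightarrow> nat \<Rightarrow> real" where
  "mult_ext w n = (\<Prod>p\<in>prime_factors n. w p (multiplicity p n))"

lemma mult_ext_1 [simp]: "mult_ext w (Suc 0) = 1"
  by (simp add: mult_ext_def)

lemma mult_ext_abs: "\<bar>mult_ext w n\<bar> = mult_ext (\<lambda>p a. \<bar>w p a\<bar>) n"
  by (simp add: mult_ext_def abs_prod)

lemma mult_ext_times:
  "mult_ext (\<lambda>p a. w p a * v p a) n = mult_ext w n * mult_ext v n"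
  by (simp add: mult_ext_def prod.distrib)

lemma mult_ext_power:
  "mult_ext (\<lambda>p a. w p a ^ k) n = mult_ext w n ^ k"
  by (simp add: mult_ext_def prod_power_distrib)

text \<open>Twisting by n^s is a geometric local weight, so a twisted Euler factor is the local
  power series evaluated at p^s.\<close>

lemma mult_ext_powr:
  assumes "n > 0"
  shows "mult_ext (\<lambda>p a. (real p powr s) ^ a) n = real n powr s"
proof -
  have "real n = (\<Prod>p\<in>prime_factors n. real p ^ multiplicity p n)"
    using prime_factorization_nat[OF assms] by (metis (no_types, lifting) of_nat_power of_nat_prod prod.cong)
  then have "real n powr s = (\<Prod>p\<in>prime_factors n. (real p ^ multiplicity p n) powr s)"
    by (simp add: prod_powr_distrib)
  also have "\<dots> = mult_ext (\<lambda>p a. (real p powr s) ^ a) n"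
    unfolding mult_ext_def
    by (intro prod.cong refl) (simp add: powr_powr powr_realpow[symmetric] prime_gt_0_nat in_prime_factors_iff mult.commute)
  finally show ?thesis by simp
qed

lemma multiplicity_prime_power_mult:
  fixes p :: nat
  assumes "prime p" "\<not> p dvd m" "m > 0" "prime q"
  shows "multiplicity q (p ^ a * m) = (if q = p then a else multiplicity q m)"
proof (cases "q = p")
  case True
  then show ?thesis using assms
    by (simp add: multiplicity_decomposeI not_prime_unit)
next
  case False
  then show ?thesis
    using assms by (simp add: prime_elem_multiplicity_mult_distrib multiplicity_distinct_prime_power)
qed

lemma prime_factors_prime_power_mult:
  fixes p :: nat
  assumes "prime p" "\<not> p dvd m" "m > 0"
  shows "prime_factors (p ^ a * m) = (if a = 0 then prime_factors m else insert p (prime_factors m))"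
  using assms by (auto simp: prime_factors_multiplicity multiplicity_prime_power_mult)

text \<open>For a = 0 the prime p is absent from \<open>prime_factors\<close>, so the right-hand
  side is correct only because \<open>w p 0 = 1\<close>.\<close>

lemma mult_ext_prime_power_mult:
  assumes "prime p" "\<not> p dvd m" "m > 0" "w p 0 = 1"
  shows "mult_ext w (p ^ a * m) = w p a * mult_ext w m"
proof (cases "a = 0")
  case False
  have "mult_ext w (p ^ a * m) = (\<Prod>q\<in>insert p (prime_factors m). w q (multiplicity q (p ^ a * m)))"
    using False assms unfolding mult_ext_def by (subst prime_factors_prime_power_mult) auto
  also have "\<dots> = w p a * (\<Prod>q\<in>prime_factors m. w q (multiplicity q (p ^ a * m)))"
    using assms by (subst prod.insert) (auto simp: multiplicity_prime_power_mult)
  also have "(\<Prod>q\<in>prime_factors m. w q (multiplicity q (p ^ a * m))) = mult_ext w m"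
    unfolding mult_ext_def using assms
    by (intro prod.cong refl) (auto simp: multiplicity_prime_power_mult in_prime_factors_iff)
  finally show ?thesis .
qed (use assms in auto)

text \<open>The exponent j is recovered from a divisor as its multiplicity at p, and every divisor
  of a product splits into divisors of the two factors.\<close>

lemma bij_betw_divisors_prime_power_mult:
  fixes p :: nat
  assumes "prime p" "\<not> p dvd m" "m > 0"
  shows "bij_betw (\<lambda>(j, d). p ^ j * d) ({..a} \<times> {d. d dvd m}) {d. d dvd p ^ a * m}"
proof (rule bij_betwI')
  fix x y assume "x \<in> {..a} \<times> {d. d dvd m}" "y \<in> {..a} \<times> {d. d dvd m}"
  then obtain i d j e where xy: "x = (i, d)" "y = (j, e)" "d dvd m" "e dvd m" by auto
  have nd: "\<not> p dvd d" "\<not> p dvd e" "d > 0" "e > 0"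
    using assms xy dvd_trans by (auto intro: dvd_pos_nat)
  show "((case x of (j, d) \<Rightarrow> p ^ j * d) = (case y of (j, d) \<Rightarrow> p ^ j * d)) = (x = y)"
  proof
    assume eq: "(case x of (j, d) \<Rightarrow> p ^ j * d) = (case y of (j, d) \<Rightarrow> p ^ j * d)"
    then have "multiplicity p (p ^ i * d) = multiplicity p (p ^ j * e)" by (simp add: xy)
    then have "i = j" using assms nd by (simp add: multiplicity_prime_power_mult)
    then show "x = y" using eq assms by (auto simp: xy)
  qed simp
next
  fix x assume "x \<in> {..a} \<times> {d. d dvd m}"
  then show "(case x of (j, d) \<Rightarrow> p ^ j * d) \<in> {d. d dvd p ^ a * m}"
    by (auto intro!: mult_dvd_mono le_imp_power_dvd)
next
  fix y assume "y \<in> {d. d dvd p ^ a * m}"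
  then obtain b c where "y = b * c" "b dvd p ^ a" "c dvd m"
    using division_decomp by blast
  moreover then obtain j where "j \<le> a" "b = p ^ j"
    using assms divides_primepow_nat by blast
  ultimately show "\<exists>x\<in>{..a} \<times> {d. d dvd m}. y = (case x of (j, d) \<Rightarrow> p ^ j * d)"
    by (intro bexI[of _ "(j, c)"]) auto
qed

text \<open>Convolution with 1 acts on the local weights by partial sums. The induction splits off
  the full power of one prime; by the bijection above the divisor sum factors.\<close>

lemma sum_divisors_mult_ext:
  assumes "n > 0" and w0: "\<And>p. prime p \<Longrightarrow> w p 0 = 1"
  shows "(\<Sum>d | d dvd n. mult_ext w d) = mult_ext (\<lambda>p a. \<Sum>j\<le>a. w p j) n"
  using \<open>n > 0\<close>
proof (induction n rule: less_induct)
  case (less n)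
  show ?case
  proof (cases "n = 1")
    case False
    then obtain p where p: "prime p" "p dvd n" using prime_factor_nat by blast
    define a where "a = multiplicity p n"
    obtain m where m: "n = p ^ a * m" "\<not> p dvd m"
      unfolding a_def using multiplicity_decompose'[of n p] p less.prems
      by (metis not_prime_unit gr_implies_not0)
    have "m > 0" using m less.prems by (cases m) auto
    have "a > 0" using p m by (cases a) auto
    then have "m < n" using m \<open>m > 0\<close> prime_gt_1_nat[OF p(1)]
      by (metis mult.left_neutral mult_less_mono1 one_less_power)
    note IH = less.IH[OF this \<open>m > 0\<close>]
    have "(\<Sum>d | d dvd n. mult_ext w d) =
          (\<Sum>(j, d)\<in>{..a} \<times> {d. d dvd m}. mult_ext w (p ^ j * d))"
      unfolding m(1) using sum.reindex_bij_betw[OF bij_betw_divisors_prime_power_mult[OF p(1) m(2) \<open>m > 0\<close>], of "mult_ext w" a]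
      by (simp add: case_prod_unfold)
    also have "\<dots> = (\<Sum>(j, d)\<in>{..a} \<times> {d. d dvd m}. w p j * mult_ext w d)"
      using p m \<open>m > 0\<close> dvd_trans w0
      by (intro sum.cong refl) (auto intro!: mult_ext_prime_power_mult intro: dvd_pos_nat)
    also have "\<dots> = (\<Sum>j\<le>a. w p j) * (\<Sum>d | d dvd m. mult_ext w d)"
      by (simp add: sum_product sum.cartesian_product)
    also have "\<dots> = (\<Sum>j\<le>a. w p j) * mult_ext (\<lambda>p a. \<Sum>j\<le>a. w p j) m"
      by (simp add: IH)
    also have "\<dots> = mult_ext (\<lambda>p a. \<Sum>j\<le>a. w p j) n"
      unfolding m(1) using p m \<open>m > 0\<close> w0 by (subst mult_ext_prime_power_mult) auto
    finally show ?thesis .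
  qed auto
qed

lemma divisor_tau_mult_ext:
  assumes "n > 0"
  shows "real (divisor_tau n) = mult_ext (\<lambda>p a. real a + 1) n"
proof -
  have "real (divisor_tau n) = (\<Sum>d | d dvd n. mult_ext (\<lambda>p a. 1) d)"
    by (simp add: divisor_tau_def mult_ext_def)
  also have "\<dots> = mult_ext (\<lambda>p a. real a + 1) n"
    using assms by (subst sum_divisors_mult_ext) (auto simp: add.commute)
  finally show ?thesis .
qed

text \<open>Finite Euler product. Adding p to P writes each admissible n uniquely as p^a m with m
  built from P, so the series is the product of the local series at p and the series for P.\<close>

lemma has_sum_mult_ext_finite_primes:
  assumes "finite P" "\<And>p. p \<in> P \<Longrightarrow> prime p" "\<And>p. p \<in> P \<Longrightarrow> w p 0 = 1"
    and "\<And>p. p \<in> P \<Longrightarrow> w p summable_on UNIV"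
  shows "(mult_ext w has_sum (\<Prod>p\<in>P. infsum (w p) UNIV)) {n. n > 0 \<and> prime_factors n \<subseteq> P}"
  using assms
proof (induction P rule: finite_induct)
  case empty
  have "{n. 0 < n \<and> prime_factors n \<subseteq> {}} = {1::nat}"
    by (auto simp: prime_factorization_empty_iff)
  then show ?case using has_sum_finite[of "{1}" "mult_ext w"] by simp
next
  case (insert p P)
  define A where "A = {n::nat. n > 0 \<and> prime_factors n \<subseteq> P}"
  have p: "prime p" "w p 0 = 1" using insert.prems by auto
  have IH: "(mult_ext w has_sum (\<Prod>p\<in>P. infsum (w p) UNIV)) A"
    unfolding A_def using insert by blast
  have nd: "\<not> p dvd m \<and> m > 0" if "m \<in> A" for m
    using that insert p unfolding A_def by (auto simp: in_prime_factors_iff subset_iff)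
  have bij: "bij_betw (\<lambda>(a, m). p ^ a * m) (UNIV \<times> A) {n. n > 0 \<and> prime_factors n \<subseteq> insert p P}"
  proof (rule bij_betwI')
    fix x y assume "x \<in> (UNIV::nat set) \<times> A" "y \<in> (UNIV::nat set) \<times> A"
    then obtain i d j e where xy: "x = (i, d)" "y = (j, e)" "d \<in> A" "e \<in> A" by auto
    show "((case x of (j, d) \<Rightarrow> p ^ j * d) = (case y of (j, d) \<Rightarrow> p ^ j * d)) = (x = y)"
    proof
      assume eq: "(case x of (j, d) \<Rightarrow> p ^ j * d) = (case y of (j, d) \<Rightarrow> p ^ j * d)"
      then have "multiplicity p (p ^ i * d) = multiplicity p (p ^ j * e)" by (simp add: xy)
      then have "i = j" using p nd xy by (simp add: multiplicity_prime_power_mult)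
      then show "x = y" using eq p by (auto simp: xy)
    qed simp
  next
    fix x assume "x \<in> (UNIV::nat set) \<times> A"
    then obtain a m where x: "x = (a, m)" "m \<in> A" by auto
    show "(case x of (a, m) \<Rightarrow> p ^ a * m) \<in> {n. n > 0 \<and> prime_factors n \<subseteq> insert p P}"
      using nd[OF x(2)] p x prime_factors_prime_power_mult[of p m a]
      by (auto simp: A_def prime_gt_0_nat split: if_splits)
  next
    fix n assume n: "n \<in> {n. n > 0 \<and> prime_factors n \<subseteq> insert p P}"
    define a where "a = multiplicity p n"
    obtain m where m: "n = p ^ a * m" "\<not> p dvd m"
      unfolding a_def using multiplicity_decompose'[of n p] p n
      by (metis (no_types, lifting) mem_Collect_eq not_prime_unit gr_implies_not0)
    have "m > 0" using m n by (cases m) auto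
    have "m dvd n" using m by simp
    have "prime_factors m \<subseteq> P"
    proof
      fix q assume q: "q \<in> prime_factors m"
      then have "q \<in> prime_factors n" using \<open>m dvd n\<close> n
        by (auto simp: in_prime_factors_iff)
      moreover have "q \<noteq> p" using q m by (auto simp: in_prime_factors_iff)
      ultimately show "q \<in> P" using n by auto
    qed
    then show "\<exists>x\<in>UNIV \<times> A. n = (case x of (a, m) \<Rightarrow> p ^ a * m)"
      using m \<open>m > 0\<close> by (intro bexI[of _ "(a, m)"]) (auto simp: A_def)
  qed
  have w: "w p summable_on UNIV" using insert.prems by auto
  \<comment> \<open>Multiplying the two series needs summability over the pairs. For real families
    unconditional and absolute summability agree, so the iterated sums of absolute values decide
    it.\<close>
  have "(\<lambda>x. norm (case x of (a, m) \<Rightarrow> w p a * mult_ext w m)) summable_on UNIV \<times> A"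
  proof (subst Infinite_Sum.abs_summable_on_Sigma_iff, intro conjI ballI)
    fix a show "(\<lambda>m. norm (case (a, m) of (a, m) \<Rightarrow> w p a * mult_ext w m)) summable_on A"
    proof -
      have "(\<lambda>m. w p a * mult_ext w m) summable_on A"
        using IH by (intro summable_on_cmult_right) (auto simp: summable_on_def)
      then show ?thesis unfolding prod.case by (rule iffD1[OF summable_on_iff_abs_summable_on_real])
    qed
  next
    have "(\<lambda>a. norm (\<bar>w p a\<bar> * (\<Sum>\<^sub>\<infinity>m\<in>A. \<bar>mult_ext w m\<bar>))) summable_on UNIV"
      using iffD1[OF summable_on_iff_abs_summable_on_real w]
      by (simp add: abs_mult summable_on_cmult_left)
    then show "(\<lambda>a. norm (\<Sum>\<^sub>\<infinity>m\<in>A. norm (case (a, m) of (a, m) \<Rightarrow> w p a * mult_ext w m))) summable_on UNIV"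
      by (simp add: abs_mult infsum_cmult_right')
  qed
  then have summ: "(\<lambda>(a, m). w p a * mult_ext w m) summable_on UNIV \<times> A"
    using summable_on_iff_abs_summable_on_real by blast
  have "((\<lambda>(a, m). w p a * mult_ext w m) has_sum (infsum (w p) UNIV * (\<Prod>p\<in>P. infsum (w p) UNIV))) (UNIV \<times> A)"
    by (rule has_sum_SigmaI[where g = "\<lambda>a. w p a * (\<Prod>p\<in>P. infsum (w p) UNIV)"])
       (use IH w summ in \<open>auto intro!: has_sum_cmult_right has_sum_cmult_left\<close>)
  also have "?this \<longleftrightarrow> ((\<lambda>x. mult_ext w (case x of (a, m) \<Rightarrow> p ^ a * m)) has_sum (infsum (w p) UNIV * (\<Prod>p\<in>P. infsum (w p) UNIV))) (UNIV \<times> A)"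
    using nd p by (intro has_sum_cong) (auto simp: mult_ext_prime_power_mult)
  also have "\<dots> \<longleftrightarrow> (mult_ext w has_sum (infsum (w p) UNIV * (\<Prod>p\<in>P. infsum (w p) UNIV))) {n. n > 0 \<and> prime_factors n \<subseteq> insert p P}"
    by (rule has_sum_reindex_bij_betw[OF bij])
  finally show ?case using insert by simp
qed

subsection \<open>Summatory functions\<close>

definition upto_nats :: "real \<Rightarrow> nat set" where
  "upto_nats x = {n. 0 < n \<and> real n \<le> x}"

lemma upto_nats_eq: "x \<ge> 0 \<Longrightarrow> upto_nats x = {1..nat \<lfloor>x\<rfloor>}"
  unfolding upto_nats_def by (auto simp: le_nat_iff le_floor_iff)

lemma finite_upto_nats [simp, intro]: "finite (upto_nats x)"
proof (rule finite_subset)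
  show "upto_nats x \<subseteq> {..nat \<lfloor>x\<rfloor>}"
    unfolding upto_nats_def by (auto simp: le_nat_iff le_floor_iff)
qed auto

text \<open>The error is y itself for y < 1 and at most 1 otherwise, and y^s dominates it in both
  ranges. Validity for small y matters: the bound is applied to y = x/d for every d > 0, also beyond
  x.\<close>

lemma card_upto_nats_approx:
  fixes y s :: real
  assumes "y > 0" "0 \<le> s" "s \<le> 1"
  shows "\<bar>real (card (upto_nats y)) - y\<bar> \<le> y powr s"
proof -
  have c: "real (card (upto_nats y)) = of_int \<lfloor>y\<rfloor>"
    using assms by (simp add: upto_nats_eq)
  show ?thesis
  proof (cases "y < 1")
    case True
    then have "\<lfloor>y\<rfloor> = 0" using assms by (simp add: floor_eq_iff)
    moreover have "y powr 1 \<le> y powr s"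
      using assms True by (intro powr_mono') auto
    ultimately show ?thesis using assms by (simp add: c)
  next
    case False
    then have "1 \<le> y powr s" using assms by (simp add: ge_one_powr_ge_zero)
    moreover have "\<bar>of_int \<lfloor>y\<rfloor> - y\<bar> \<le> 1" by linarith
    ultimately show ?thesis by (simp add: c)
  qed
qed

section \<open>Divisor sums as sums over pairs (d, e) with d e at most x\<close>

lemma factor_le_if_mult_le:
  assumes "real d * real e \<le> x" "0 < e"
  shows "real d \<le> x"
proof -
  have "real d * 1 \<le> real d * real e"
    using assms by (intro mult_left_mono) auto
  then show ?thesis using assms by linarith
qed

text \<open>Substituting n = d e turns the double sum into one over a region symmetric in d and e;
  the next two lemmas sum it in the two possible orders.\<close>

lemma sum_divisors_upto_eq_Sigma:
  fixes f :: "nat \<Rightarrow> real"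
  shows "(\<Sum>n\<in>upto_nats x. \<Sum>d | d dvd n. f d) =
         (\<Sum>(d, e)\<in>Sigma (upto_nats x) (\<lambda>d. upto_nats (x / d)). f d)"
proof -
  have "(\<Sum>n\<in>upto_nats x. \<Sum>d | d dvd n. f d) =
        (\<Sum>(n, d)\<in>Sigma (upto_nats x) (\<lambda>n. {d. d dvd n}). f d)"
    by (rule sum.Sigma) (auto, auto simp: upto_nats_def)
  also have "\<dots> = (\<Sum>(d, e)\<in>Sigma (upto_nats x) (\<lambda>d. upto_nats (x / d)). f d)"
  proof (rule sum.reindex_bij_witness[where i = "\<lambda>(d, e). (d * e, d)" and j = "\<lambda>(n, d). (d, n div d)"], goal_cases)
    case (2 z)
    then obtain n d where z: "z = (n, d)" "n > 0" "real n \<le> x" "d dvd n" 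
      by (auto simp: upto_nats_def)
    then obtain e where e: "n = d * e" by auto
    then have "d > 0" "e > 0" using z by auto
    then have "real d \<le> x" using z e factor_le_if_mult_le[of d e x] by simp
    then show ?case using z e \<open>d > 0\<close> \<open>e > 0\<close>
      by (simp add: upto_nats_def field_simps)
  qed (auto simp: upto_nats_def field_simps)
  finally show ?thesis .
qed

lemma sum_divisors_upto_card:
  fixes f :: "nat \<Rightarrow> real"
  shows "(\<Sum>n\<in>upto_nats x. \<Sum>d | d dvd n. f d) = (\<Sum>d\<in>upto_nats x. f d * card (upto_nats (x / d)))"
  unfolding sum_divisors_upto_eq_Sigma by (subst sum.Sigma[symmetric]) (auto simp: mult.commute)

lemma sum_divisors_upto_nested:
  fixes f :: "nat \<Rightarrow> real"
  shows "(\<Sum>n\<in>upto_nats x. \<Sum>d | d dvd n. f d) = (\<Sum>e\<in>upto_nats x. \<Sum>d\<in>upto_nats (x / e). f d)"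
proof -
  have *: "d \<in> upto_nats x \<and> e \<in> upto_nats (x / d) \<longleftrightarrow> e \<in> upto_nats x \<and> d \<in> upto_nats (x / e)" for d e
  proof (cases "d > 0 \<and> e > 0")
    case True
    then show ?thesis using factor_le_if_mult_le[of d e x] factor_le_if_mult_le[of e d x]
      by (auto simp: upto_nats_def field_simps)
  qed (auto simp: upto_nats_def)
  have "(\<Sum>(d, e)\<in>Sigma (upto_nats x) (\<lambda>d. upto_nats (x / d)). f d) = 
        (\<Sum>(e, d)\<in>Sigma (upto_nats x) (\<lambda>e. upto_nats (x / e)). f d)"
    by (rule sum.reindex_bij_witness[where i = "\<lambda>(d, e). (e, d)" and j = "\<lambda>(d, e). (e, d)"])
       (use * in auto)
  also have "\<dots> = (\<Sum>e\<in>upto_nats x. \<Sum>d\<in>upto_nats (x / e). f d)"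
    by (rule sum.Sigma[symmetric]) auto
  finally show ?thesis unfolding sum_divisors_upto_eq_Sigma .
qed

text \<open>Since x/d has floor 0 for d > x, the sum of f(d) floor(x/d) may run over all d > 0. It
  is then compared termwise with x f(d)/d, at a cost of |f(d)| (x/d)^s per term, and no tail remains
  to be estimated.\<close>

lemma sum_divisors_asymp:
  fixes f :: "nat \<Rightarrow> real"
  assumes s: "0 \<le> s" "s \<le> 1" 
    and A: "((\<lambda>n. \<bar>f n\<bar> * real n powr - s) has_sum A) {0<..}"
    and G: "((\<lambda>n. f n / real n) has_sum G) {0<..}"
    and "x > 0"
  shows "\<bar>(\<Sum>n\<in>upto_nats x. \<Sum>d | d dvd n. f d) - G * x\<bar> \<le> A * x powr s"
proof -
  have "((\<lambda>d. f d * card (upto_nats (x / d))) has_sum (\<Sum>n\<in>upto_nats x. \<Sum>d | d dvd n. f d)) {0<..}"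
    unfolding sum_divisors_upto_card
  proof (rule has_sum_finite_neutralI)
    have "upto_nats (x / real d) = {}" if "d > 0" "real d > x" for d
    proof -
      have "x / real d < 1" using that by simp
      moreover have "real n \<ge> 1" if "n > 0" for n using that by simp
      ultimately show ?thesis unfolding upto_nats_def by force
    qed
    moreover have "d > 0 \<and> real d > x" if "d \<in> {0<..} - upto_nats x" for d
      using that by (auto simp: upto_nats_def)
    ultimately show "f d * card (upto_nats (x / real d)) = 0" if "d \<in> {0<..} - upto_nats x" for d
      using that by simp
  qed (use finite_upto_nats in \<open>auto simp: upto_nats_def\<close>)
  from has_sum_add[OF this has_sum_cmult_left[OF G, of "- x"]]
  have *: "((\<lambda>d. f d * card (upto_nats (x / d)) - f d / d * x) has_sum
     ((\<Sum>n\<in>upto_nats x. \<Sum>d | d dvd n. f d) - G * x)) {0<..}" by simp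
  show ?thesis
  proof (rule norm_infsum_le[OF * has_sum_cmult_left[OF A, of "x powr s"], unfolded real_norm_def])
    fix d :: nat assume d: "d \<in> {0<..}"
    have "\<bar>f d * card (upto_nats (x / d)) - f d / d * x\<bar> = \<bar>f d\<bar> * \<bar>card (upto_nats (x / d)) - x / d\<bar>"
      by (simp add: abs_mult[symmetric] algebra_simps)
    also have "\<dots> \<le> \<bar>f d\<bar> * (x / d) powr s"
      using d s \<open>x > 0\<close> by (intro mult_left_mono card_upto_nats_approx) auto
    also have "\<dots> = \<bar>f d\<bar> * real d powr - s * x powr s"
      using d \<open>x > 0\<close> by (simp add: powr_divide powr_minus field_simps)
    finally show "\<bar>f d * card (upto_nats (x / d)) - f d / d * x\<bar> \<le> \<bar>f d\<bar> * real d powr - s * x powr s" .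
  qed
qed

text \<open>Integral comparison for a nonincreasing g, with the antiderivative F in place of the
  integral: the mean value theorem bounds each increment of F by values of g at the end
  points.\<close>

lemma sum_upto_antimono_approx:
  fixes g F :: "real \<Rightarrow> real"
  assumes "x \<ge> 1"
    and deriv: "\<And>t. 1 \<le> t \<Longrightarrow> t \<le> x \<Longrightarrow> (F has_real_derivative g t) (at t)"
    and anti: "\<And>s t. 1 \<le> s \<Longrightarrow> s \<le> t \<Longrightarrow> t \<le> x \<Longrightarrow> g t \<le> g s"
    and nonneg: "\<And>t. 1 \<le> t \<Longrightarrow> t \<le> x \<Longrightarrow> 0 \<le> g t"
  shows "(\<Sum>n\<in>upto_nats x. g (real n)) - (F x - F 1) \<in> {0..g 1}"
proof -
  have mvt: "(b - a) * g b \<le> F b - F a \<and> F b - F a \<le> (b - a) * g a" if "1 \<le> a" "a \<le> b" "b \<le> x" for a b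
  proof (cases "a = b")
    case False
    then have "a < b" using that by simp
    moreover have "(F has_real_derivative g t) (at t)" if "a \<le> t" "t \<le> b" for t
      using that \<open>1 \<le> a\<close> \<open>b \<le> x\<close> by (intro deriv) auto
    ultimately obtain z where z: "z > a" "z < b" "F b - F a = (b - a) * g z"
      using MVT2[of a b F g] by blast
    show ?thesis unfolding z(3) using z that
      by (intro conjI mult_left_mono anti) auto
  qed auto
  \<comment> \<open>The lower bound is \<open>g (Suc k)\<close> rather than 0: this reserve pays for
    the last, incomplete interval from \<open>Suc k\<close> to x, over which F grows by at most
    \<open>g (Suc k)\<close>.\<close>
  have *: "(\<Sum>n=1..Suc k. g (real n)) - (F (Suc k) - F 1) \<in> {g (Suc k)..g 1}" if "real (Suc k) \<le> x" for k
    using that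
  proof (induction k)
    case (Suc k)
    from Suc.IH Suc.prems have IH: "(\<Sum>n=1..Suc k. g (real n)) - (F (Suc k) - F 1) \<in> {g (Suc k)..g 1}"
      by simp
    have "real (Suc (Suc k)) - real (Suc k) = 1" by simp
    with mvt[of "real (Suc k)" "real (Suc (Suc k))"] Suc.prems
    have "g (Suc (Suc k)) \<le> F (Suc (Suc k)) - F (Suc k)" "F (Suc (Suc k)) - F (Suc k) \<le> g (Suc k)"
      by simp_all
    moreover have "(\<Sum>n=1..Suc (Suc k). g (real n)) = (\<Sum>n=1..Suc k. g (real n)) + g (Suc (Suc k))"
      by simp
    ultimately show ?case using IH unfolding atLeastAtMost_iff by linarith
  qed auto
  define k where "k = nat \<lfloor>x\<rfloor> - 1"
  have k: "nat \<lfloor>x\<rfloor> = Suc k" and k': "real (Suc k) \<le> x" "x - real (Suc k) \<le> 1"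
    using \<open>x \<ge> 1\<close> unfolding k_def by linarith+
  have un: "upto_nats x = {1..Suc k}" using \<open>x \<ge> 1\<close> k by (simp add: upto_nats_eq)
  have "0 \<le> F x - F (Suc k)" "F x - F (Suc k) \<le> g (Suc k)"
  proof -
    have m: "(x - real (Suc k)) * g x \<le> F x - F (Suc k)" "F x - F (Suc k) \<le> (x - real (Suc k)) * g (Suc k)"
      using mvt[of "real (Suc k)" x] k' by auto
    have "0 \<le> (x - real (Suc k)) * g x"
      using k' \<open>x \<ge> 1\<close> nonneg[of x] by (intro mult_nonneg_nonneg) auto
    then show "0 \<le> F x - F (Suc k)" using m by linarith
    have "(x - real (Suc k)) * g (Suc k) \<le> 1 * g (Suc k)"
      using k' nonneg[of "Suc k"] by (intro mult_right_mono) auto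
    then show "F x - F (Suc k) \<le> g (Suc k)" using m by linarith
  qed
  then show ?thesis
    using *[OF k'(1)] nonneg[of "Suc k"] k' unfolding atLeastAtMost_iff un by (intro conjI) linarith+
qed

text \<open>The antiderivative -ln(x/t)^(i+1)/(i+1) vanishes at t = x. The divisor i + 1 produced
  here builds up the factorial in the main term.\<close>

lemma sum_ln_power_div_approx:
  assumes "x \<ge> (1::real)"
  shows "(\<Sum>n\<in>upto_nats x. ln (x / real n) ^ i / real n) - ln x ^ Suc i / Suc i \<in> {0..ln x ^ i}"
proof -
  have "(\<Sum>n\<in>upto_nats x. ln (x / real n) ^ i / real n) - 
     ((- (ln (x / x) ^ Suc i) / Suc i) - (- (ln (x / 1) ^ Suc i) / Suc i)) \<in> {0..ln (x / 1) ^ i / 1}"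
  proof (rule sum_upto_antimono_approx[where F = "\<lambda>t. - (ln (x / t) ^ Suc i) / Suc i" and g = "\<lambda>t. ln (x / t) ^ i / t"])
    fix t assume t: "1 \<le> t" "t \<le> x"
    show "((\<lambda>t. - (ln (x / t) ^ Suc i) / Suc i) has_real_derivative ln (x / t) ^ i / t) (at t)"
    proof -
      have "((\<lambda>t. ln (x / t)) has_real_derivative - 1 / t) (at t)"
        using t by (auto intro!: derivative_eq_intros simp: field_simps power2_eq_square)
      then have "((\<lambda>t. - (ln (x / t) ^ Suc i) / Suc i) has_real_derivative
          - (real (Suc i) * (- 1 / t * ln (x / t) ^ i)) / Suc i) (at t)"
        by (intro DERIV_cdivide DERIV_minus) (use DERIV_power[of "\<lambda>t. ln (x / t)" "- 1 / t" t UNIV "Suc i"] in simp)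
      then show ?thesis by (simp del: of_nat_Suc)
    qed
    show "0 \<le> ln (x / t) ^ i / t" using t by (intro divide_nonneg_nonneg zero_le_power ln_ge_zero) auto
  next
    fix s t assume t: "1 \<le> s" "s \<le> t" "t \<le> x"
    then show "ln (x / t) ^ i / t \<le> ln (x / s) ^ i / s"
      by (intro frac_le power_mono zero_le_power ln_ge_zero ln_mono) (auto simp: field_simps)
  qed (use assms in auto)
  then show ?thesis using assms by simp
qed

text \<open>The comparison error of at most 1 is absorbed by the lower boundary term 1/(1 - s),
  which is at least 1.\<close>

lemma sum_powr_neg_le:
  fixes s :: real
  assumes "x \<ge> (1::real)" "0 < s" "s < 1"
  shows "(\<Sum>n\<in>upto_nats x. real n powr - s) \<le> x powr (1 - s) / (1 - s)"
proof -
  have "(\<Sum>n\<in>upto_nats x. real n powr - s) - (x powr (1 - s) / (1 - s) - 1 powr (1 - s) / (1 - s)) \<in> {0..1 powr - s}"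
  proof (rule sum_upto_antimono_approx[where F = "\<lambda>t. t powr (1 - s) / (1 - s)" and g = "\<lambda>t. t powr - s"])
    fix t assume t: "1 \<le> t" "t \<le> x"
    show "((\<lambda>t. t powr (1 - s) / (1 - s)) has_real_derivative t powr - s) (at t)"
      using t assms DERIV_cdivide[OF has_real_derivative_powr[of t "1 - s"], of "1 - s"] by simp
  qed (use assms in \<open>auto intro!: powr_mono2'\<close>)
  moreover have "1 / (1 - s) \<ge> 1" using assms by simp
  ultimately show ?thesis using assms unfolding atLeastAtMost_iff powr_one_eq_one by linarith
qed

text \<open>The error carries 1 + ln x instead of ln x because the recursion evaluates it at x/e,
  which comes down to 1, where the logarithm vanishes but the error need not.\<close>

lemma iterated_sum_divisors_asymp:
  fixes F :: "nat \<Rightarrow> nat \<Rightarrow> real"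
  assumes F: "\<And>j n. n > 0 \<Longrightarrow> F (Suc j) n = (\<Sum>d | d dvd n. F j d)"
    and s: "0 < s" "s < 1" 
    and A: "((\<lambda>n. \<bar>F 0 n\<bar> * real n powr - s) has_sum A) {0<..}"
    and G: "((\<lambda>n. F 0 n / real n) has_sum G) {0<..}"
  shows "\<exists>K. \<forall>x\<ge>1. \<bar>(\<Sum>n\<in>upto_nats x. F (i + 2) n) - G * x * ln x ^ (i + 1) / fact (i + 1)\<bar>
           \<le> K * x * (1 + ln x) ^ i"
proof -
  define S where "S j x = (\<Sum>n\<in>upto_nats x. F j n)" for j x
  have S_Suc: "S (Suc j) x = (\<Sum>e\<in>upto_nats x. S j (x / e))" for j x
  proof -
    have "S (Suc j) x = (\<Sum>n\<in>upto_nats x. \<Sum>d | d dvd n. F j d)"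
      unfolding S_def by (intro sum.cong refl F) (auto simp: upto_nats_def)
    then show ?thesis unfolding sum_divisors_upto_nested S_def .
  qed
  \<comment> \<open>One convolution with 1 makes two errors: replacing the sum of ln(x/e)^i / e by
    its integral, and the inherited error summed over e. The bound E is left arbitrary, being y^s up
    to a constant at first and K y (1 + ln y)^i afterwards.\<close>
  have main: "\<bar>S (Suc j) x - G * x * ln x ^ Suc i / fact (Suc i)\<bar> \<le> \<bar>G\<bar> * x * ln x ^ i + (\<Sum>e\<in>upto_nats x. E (x / e))"
    if "x \<ge> 1" and E: "\<And>y. y \<ge> 1 \<Longrightarrow> \<bar>S j y - G * y * ln y ^ i / fact i\<bar> \<le> E y" for x E i j
  proof -
    have "\<bar>S (Suc j) x - G * x / fact i * (\<Sum>e\<in>upto_nats x. ln (x / e) ^ i / e)\<bar> = 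
      \<bar>\<Sum>e\<in>upto_nats x. S j (x / e) - G * (x / e) * ln (x / e) ^ i / fact i\<bar>"
      by (simp add: S_Suc sum_subtractf sum_distrib_left mult_ac)
    also have "\<dots> \<le> (\<Sum>e\<in>upto_nats x. E (x / e))"
      by (intro order.trans[OF sum_abs] sum_mono E) (auto simp: upto_nats_def)
    finally have 1: "\<bar>S (Suc j) x - G * x / fact i * (\<Sum>e\<in>upto_nats x. ln (x / e) ^ i / e)\<bar> \<le> (\<Sum>e\<in>upto_nats x. E (x / e))" .
    have "\<bar>(\<Sum>e\<in>upto_nats x. ln (x / e) ^ i / e) - ln x ^ Suc i / Suc i\<bar> \<le> ln x ^ i"
      using sum_ln_power_div_approx[OF that(1), of i] by auto
    then have "\<bar>G * x / fact i\<bar> * \<bar>(\<Sum>e\<in>upto_nats x. ln (x / e) ^ i / e) - ln x ^ Suc i / Suc i\<bar> \<le> \<bar>G * x / fact i\<bar> * ln x ^ i"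
      by (intro mult_left_mono) auto
    also have "\<dots> \<le> \<bar>G\<bar> * x * ln x ^ i"
    proof (intro mult_right_mono)
      have "\<bar>G * x / fact i\<bar> = \<bar>G\<bar> * x / fact i" using that by (simp add: abs_mult)
      also have "\<dots> \<le> \<bar>G\<bar> * x / 1" using that by (intro divide_left_mono) auto
      finally show "\<bar>G * x / fact i\<bar> \<le> \<bar>G\<bar> * x" by simp
    qed (use that in auto)
    finally have 2: "\<bar>G * x / fact i * (\<Sum>e\<in>upto_nats x. ln (x / e) ^ i / e) - G * x / fact i * (ln x ^ Suc i / Suc i)\<bar> \<le> \<bar>G\<bar> * x * ln x ^ i"
      by (simp only: abs_mult[symmetric] right_diff_distrib)
    have 3: "G * x / fact i * (ln x ^ Suc i / Suc i) = G * x * ln x ^ Suc i / fact (Suc i)"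
      by (simp add: field_simps)
    have tri: "\<bar>a - c\<bar> \<le> \<delta> + \<epsilon>" if "\<bar>b - c\<bar> \<le> \<delta>" "\<bar>a - b\<bar> \<le> \<epsilon>" for a b c \<delta> \<epsilon> :: real
      using that by linarith
    show ?thesis by (rule tri[OF 2[unfolded 3] 1])
  qed
  have base: "\<bar>S 1 y - G * y * ln y ^ 0 / fact 0\<bar> \<le> A * y powr s" if "y \<ge> 1" for y
  proof -
    have "S 1 y = (\<Sum>n\<in>upto_nats y. \<Sum>d | d dvd n. F 0 d)"
      unfolding S_def One_nat_def by (intro sum.cong refl F) (auto simp: upto_nats_def)
    then show ?thesis using sum_divisors_asymp[OF _ _ A G, of y] s that by simp
  qed
  have "A \<ge> 0" using has_sum_nonneg[OF A] by simp
  show ?thesis unfolding S_def[symmetric]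
  proof (induction i)
    case 0
    show ?case
    proof (intro exI[of _ "\<bar>G\<bar> + A / (1 - s)"] allI impI)
      fix x :: real assume x: "x \<ge> 1"
      \<comment> \<open>Because s < 1, the factors x^s and x^(1-s) combine to x, without a
        logarithm.\<close>
      have "(\<Sum>e\<in>upto_nats x. A * (x / e) powr s) = A * x powr s * (\<Sum>e\<in>upto_nats x. real e powr - s)"
        using x by (simp add: sum_distrib_left powr_divide powr_minus field_simps)
      also have "\<dots> \<le> A * x powr s * (x powr (1 - s) / (1 - s))"
        using \<open>A \<ge> 0\<close> s x by (intro mult_left_mono sum_powr_neg_le) auto
      also have "\<dots> = A / (1 - s) * x" using x by (simp add: powr_add[symmetric])
      finally have "(\<Sum>e\<in>upto_nats x. A * (x / e) powr s) \<le> A / (1 - s) * x" .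
      with main[OF x base] 
      show "\<bar>S (0 + 2) x - G * x * ln x ^ (0 + 1) / fact (0 + 1)\<bar> \<le> (\<bar>G\<bar> + A / (1 - s)) * x * (1 + ln x) ^ 0"
        by (simp add: numeral_2_eq_2 algebra_simps)
    qed
  next
    case (Suc i)
    then obtain K where K: "\<And>x. x \<ge> 1 \<Longrightarrow> \<bar>S (i + 2) x - G * x * ln x ^ (i + 1) / fact (i + 1)\<bar> \<le> K * x * (1 + ln x) ^ i"
      by blast
    have "K \<ge> 0" using K[of 1] by simp
    show ?case
    proof (intro exI[of _ "\<bar>G\<bar> + K"] allI impI)
      fix x :: real assume x: "x \<ge> 1"
      have ln: "ln x \<ge> 0" using x by simp
      have "(\<Sum>e\<in>upto_nats x. 1 / real e) \<le> 1 + ln x"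
        using sum_ln_power_div_approx[OF x, of 0] by simp
      \<comment> \<open>Bounding ln(x/e) by ln x leaves a harmonic sum, which supplies the one new
        factor 1 + ln x.\<close>
      have "(\<Sum>e\<in>upto_nats x. K * (x / e) * (1 + ln (x / e)) ^ i) \<le> (\<Sum>e\<in>upto_nats x. K * (x / e) * (1 + ln x) ^ i)"
      proof (intro sum_mono mult_left_mono power_mono)
        fix e assume e: "e \<in> upto_nats x"
        then have "x / e \<ge> 1" "x / e \<le> x" by (auto simp: upto_nats_def field_simps)
        then show "1 + ln (x / e) \<le> 1 + ln x" "0 \<le> 1 + ln (x / e)" "0 \<le> K * (x / e)"
          using \<open>K \<ge> 0\<close> x by (auto intro: add_nonneg_nonneg)
      qed
      also have "\<dots> = K * x * (1 + ln x) ^ i * (\<Sum>e\<in>upto_nats x. 1 / real e)"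
        by (simp add: sum_distrib_left field_simps)
      also have "\<dots> \<le> K * x * (1 + ln x) ^ i * (1 + ln x)"
        using \<open>(\<Sum>e\<in>upto_nats x. 1 / real e) \<le> 1 + ln x\<close> \<open>K \<ge> 0\<close> x ln by (intro mult_left_mono) auto
      finally have 1: "(\<Sum>e\<in>upto_nats x. K * (x / e) * (1 + ln (x / e)) ^ i) \<le> K * x * (1 + ln x) ^ Suc i"
        by (simp add: mult_ac)
      have 2: "\<bar>G\<bar> * x * ln x ^ (i + 1) \<le> \<bar>G\<bar> * x * (1 + ln x) ^ Suc i"
        using x ln by (intro mult_left_mono) (auto intro!: power_mono simp del: power_Suc)
      have "\<bar>S (Suc (i + 2)) x - G * x * ln x ^ Suc (i + 1) / fact (Suc (i + 1))\<bar> \<le> (\<bar>G\<bar> + K) * x * (1 + ln x) ^ Suc i"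
        using main[OF x K] 1 2 unfolding distrib_right by linarith
      then show "\<bar>S (Suc i + 2) x - G * x * ln x ^ (Suc i + 1) / fact (Suc i + 1)\<bar> \<le> (\<bar>G\<bar> + K) * x * (1 + ln x) ^ Suc i"
        by simp
    qed
  qed
qed

subsection \<open>Euler products\<close>

text \<open>Termwise differentiation of the series for r gives coefficients (a + 1)(a + 2)^r, which
  dominate (a + 1)^(r+1).\<close>

lemma summable_Suc_power_times_power:
  fixes z :: real
  assumes "\<bar>z\<bar> < 1"
  shows "summable (\<lambda>a. (real a + 1) ^ r * z ^ a)"
  using assms
proof (induction r arbitrary: z)
  case 0
  then show ?case by (simp add: summable_geometric)
next
  case (Suc r)
  have *: "summable (\<lambda>a. (real a + 1) * (real a + 2) ^ r * \<bar>z\<bar> ^ a)"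
    using termdiff_converges[of "\<bar>z\<bar>" 1 "\<lambda>a. (real a + 1) ^ r"] Suc
    by (simp add: diffs_def add_ac)
  show ?case
  proof (rule summable_comparison_test'[OF *])
    fix a
    have "norm ((real a + 1) ^ Suc r * z ^ a) = (real a + 1) * (real a + 1) ^ r * \<bar>z\<bar> ^ a"
      by (simp add: abs_mult power_abs)
    also have "\<dots> \<le> (real a + 1) * (real a + 2) ^ r * \<bar>z\<bar> ^ a"
      by (intro mult_right_mono mult_left_mono power_mono) auto
    finally show "norm ((real a + 1) ^ Suc r * z ^ a) \<le> (real a + 1) * (real a + 2) ^ r * \<bar>z\<bar> ^ a" .
  qed
qed

section \<open>Backward differences and partial sums of local weights\<close>

definition bdiff :: "(nat \<Rightarrow> real) \<Rightarrow> nat \<Rightarrow> real" where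
  "bdiff f a = f a - (case a of 0 \<Rightarrow> 0 | Suc b \<Rightarrow> f b)"

lemma bdiff_0 [simp]: "bdiff f 0 = f 0"
  by (simp add: bdiff_def)

lemma bdiff_Suc [simp]: "bdiff f (Suc a) = f (Suc a) - f a"
  by (simp add: bdiff_def)

lemma sum_bdiff: "(\<Sum>j\<le>a. bdiff f j) = f a"
  by (induction a) auto

text \<open>On generating functions \<open>psum\<close> is multiplication by 1/(1 - X), the Euler
  factor of one convolution with 1, while \<open>bdiff\<close>, with value 0 assumed before index 0,
  is multiplication by 1 - X.\<close>

definition psum :: "(nat \<Rightarrow> real) \<Rightarrow> nat \<Rightarrow> real" where
  "psum f a = (\<Sum>j\<le>a. f j)"

lemma psum_bdiff: "psum (bdiff f) = f"
  by (rule ext) (simp add: psum_def sum_bdiff)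

lemma funpow_psum_bdiff: "(psum ^^ j) ((bdiff ^^ j) f) = f"
proof (induction j arbitrary: f)
  case (Suc j)
  show ?case using Suc[of "bdiff f"] by (simp add: psum_bdiff funpow_swap1[of bdiff])
qed auto

lemma funpow_psum_0: "(psum ^^ j) f 0 = f 0"
  by (induction j) (auto simp: psum_def)

lemma funpow_bdiff_0 [simp]: "(bdiff ^^ j) f 0 = f 0"
  by (induction j) auto

text \<open>The linear coefficient of (1 - X)^j f(X); it determines how many differences make the
  local weight at exponent 1 vanish.\<close>

lemma funpow_bdiff_1: "(bdiff ^^ j) f (Suc 0) = f (Suc 0) - real j * f 0"
  by (induction j) (auto simp: algebra_simps)

text \<open>Each difference at most doubles a monotone bound, since the value at the preceding index
  obeys the same bound.\<close>

lemma abs_funpow_bdiff_le: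
  assumes "mono b" "\<And>a. \<bar>f a\<bar> \<le> b a"
  shows "\<bar>(bdiff ^^ j) f a\<bar> \<le> 2 ^ j * b a"
proof (induction j arbitrary: a)
  case (Suc j)
  have "\<bar>bdiff ((bdiff ^^ j) f) a\<bar> \<le> 2 ^ j * b a + 2 ^ j * b a"
  proof (cases a)
    case 0
    have "0 \<le> 2 ^ j * b 0" using order.trans[OF abs_ge_zero Suc[of 0]] .
    then have "\<bar>f 0\<bar> \<le> 2 ^ j * b 0 + 2 ^ j * b 0"
      using Suc[of 0] unfolding funpow_bdiff_0 by linarith
    then show ?thesis unfolding 0 bdiff_0 funpow_bdiff_0 .
  next
    case (Suc a')
    have "2 ^ j * b a' \<le> 2 ^ j * b a"
      using monoD[OF assms(1), of a' a] Suc by (intro mult_left_mono) auto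
    then have "\<bar>(bdiff ^^ j) f a'\<bar> \<le> 2 ^ j * b a"
      using Suc.IH[of a'] by linarith
    moreover have "\<bar>bdiff ((bdiff ^^ j) f) a\<bar> \<le> \<bar>(bdiff ^^ j) f a\<bar> + \<bar>(bdiff ^^ j) f a'\<bar>"
      using Suc by simp
    ultimately show ?thesis using Suc.IH[of a] by linarith
  qed
  then show ?case by (simp add: mult_ac)
qed (use assms in auto)

lemma bdiff_power_series_sums:
  assumes "(\<lambda>a. f a * z ^ a) sums s"
  shows "(\<lambda>a. (bdiff ^^ j) f a * z ^ a) sums ((1 - z) ^ j * s)"
proof (induction j)
  case (Suc j)
  define g where "g = (bdiff ^^ j) f"
  have "(\<lambda>a. case a of 0 \<Rightarrow> 0 | Suc b \<Rightarrow> g b * z ^ b) sums ((1 - z) ^ j * s)"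
    using Suc sums_Suc_iff[of "\<lambda>a. case a of 0 \<Rightarrow> 0 | Suc b \<Rightarrow> g b * z ^ b"] by (simp add: g_def)
  from sums_diff[OF Suc sums_mult[OF this, of z]]
  have "(\<lambda>a. g a * z ^ a - z * (case a of 0 \<Rightarrow> 0 | Suc b \<Rightarrow> g b * z ^ b)) sums ((1 - z) ^ Suc j * s)"
    by (simp add: g_def algebra_simps)
  moreover have "g a * z ^ a - z * (case a of 0 \<Rightarrow> 0 | Suc b \<Rightarrow> g b * z ^ b) = (bdiff ^^ Suc j) f a * z ^ a" for a
    by (cases a) (auto simp: g_def algebra_simps)
  ultimately show ?case by simp
qed (use assms in auto)

text \<open>For a >= 2 and z <= z0 one has z^a <= (z/z0)^2 z0^a, so everything past the constant
  term is at most (z/z0)^2 times the series at z0.\<close>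

lemma power_series_quadratic_bound:
  fixes h :: "nat \<Rightarrow> real"
  assumes h: "h 0 = 1" "h (Suc 0) = 0"
    and summ: "\<And>z. 0 \<le> z \<Longrightarrow> z < 1 \<Longrightarrow> summable (\<lambda>a. \<bar>h a\<bar> * z ^ a)"
    and z0: "0 < z0" "z0 < 1"
  shows "\<exists>C\<ge>0. \<forall>z\<in>{0..z0}. (\<Sum>a. \<bar>h a\<bar> * z ^ a) \<le> 1 + C * z\<^sup>2 \<and>
           \<bar>(\<Sum>a. h a * z ^ a) - 1\<bar> \<le> C * z\<^sup>2"
proof -
  define C where "C = (\<Sum>a. \<bar>h a\<bar> * z0 ^ a) / z0\<^sup>2"
  have "C \<ge> 0" unfolding C_def using z0 summ by (intro divide_nonneg_nonneg suminf_nonneg) auto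
  moreover have "(\<Sum>a. \<bar>h a\<bar> * z ^ a) \<le> 1 + C * z\<^sup>2 \<and> \<bar>(\<Sum>a. h a * z ^ a) - 1\<bar> \<le> C * z\<^sup>2"
    if "z \<in> {0..z0}" for z
  proof (rule conjI)
    have z: "0 \<le> z" "z \<le> z0" using that by auto
    have sz: "summable (\<lambda>a. \<bar>h a\<bar> * z ^ a)" using z z0 summ by simp
    define e :: "nat \<Rightarrow> real" where "e = (\<lambda>a. if a = 0 then 1 else 0)"
    have e: "e sums 1" unfolding e_def using sums_single[of 0 "\<lambda>_. 1::real"] by simp
    have le: "\<bar>h a\<bar> * z ^ a \<le> e a + z\<^sup>2 / z0\<^sup>2 * (\<bar>h a\<bar> * z0 ^ a)" for a
    proof -
      consider "a = 0" | "a = 1" | b where "a = b + 2"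
        by (metis One_nat_def less_2_cases le_add_diff_inverse2 not_le)
      then show ?thesis
      proof cases
        case 3
        have "\<bar>h a\<bar> * z ^ a = z\<^sup>2 * (\<bar>h a\<bar> * z ^ b)" by (simp add: 3 power_add power2_eq_square)
        also have "\<dots> \<le> z\<^sup>2 * (\<bar>h a\<bar> * z0 ^ b)"
          using z by (intro mult_left_mono power_mono) auto
        also have "\<dots> = z\<^sup>2 / z0\<^sup>2 * (\<bar>h a\<bar> * z0 ^ a)" using z0 by (simp add: 3 power_add power2_eq_square)
        finally show ?thesis by (simp add: e_def 3)
      qed (use h in \<open>auto simp: e_def\<close>)
    qed
    have *: "(\<lambda>a. e a + z\<^sup>2 / z0\<^sup>2 * (\<bar>h a\<bar> * z0 ^ a)) sums (1 + C * z\<^sup>2)"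
      using sums_add[OF e sums_mult[OF summable_sums[OF summ[of z0]], of "z\<^sup>2 / z0\<^sup>2"]] z0
      by (simp add: C_def mult_ac)
    show abs_le: "(\<Sum>a. \<bar>h a\<bar> * z ^ a) \<le> 1 + C * z\<^sup>2"
      using suminf_le[OF le sz sums_summable[OF *]] sums_unique[OF *] by simp
    have s': "summable (\<lambda>a. h a * z ^ a)"
      by (rule summable_rabs_cancel) (use sz z in \<open>simp add: abs_mult\<close>)
    \<comment> \<open>As \<open>h 0 = 1\<close>, removing the constant term commutes with taking
      absolute values, and the second bound reduces to the first.\<close>
    have eq: "\<bar>h a * z ^ a - e a\<bar> = \<bar>h a\<bar> * z ^ a - e a" for a
      using h z by (auto simp: e_def abs_mult)
    have "summable (\<lambda>a. \<bar>h a\<bar> * z ^ a - e a)"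
      using summable_diff[OF sz sums_summable[OF e]] .
    then have "\<bar>\<Sum>a. h a * z ^ a - e a\<bar> \<le> (\<Sum>a. \<bar>h a\<bar> * z ^ a - e a)"
      using summable_rabs[of "\<lambda>a. h a * z ^ a - e a"] by (simp add: eq)
    then show "\<bar>(\<Sum>a. h a * z ^ a) - 1\<bar> \<le> C * z\<^sup>2"
      using abs_le suminf_diff[OF s' sums_summable[OF e]] suminf_diff[OF sz sums_summable[OF e]] sums_unique[OF e]
      by simp
  qed
  ultimately show ?thesis by blast
qed

section \<open>Dirichlet series and their Euler products\<close>

lemma mult_ext_powr_weight:
  "n > 0 \<Longrightarrow> mult_ext (\<lambda>p a. h a * (real p powr s) ^ a) n = mult_ext (\<lambda>_. h) n * real n powr s"
  using mult_ext_times[of "\<lambda>_. h" "\<lambda>p a. (real p powr s) ^ a" n] by (simp add: mult_ext_powr)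

lemma has_sum_mult_ext_power_series:
  fixes h :: "nat \<Rightarrow> real"
  assumes h: "h 0 = 1"
    and summ: "\<And>z. 0 \<le> z \<Longrightarrow> z < 1 \<Longrightarrow> summable (\<lambda>a. \<bar>h a\<bar> * z ^ a)"
    and "s > 0" "finite P" "\<And>p. p \<in> P \<Longrightarrow> prime p"
  shows "((\<lambda>n. mult_ext (\<lambda>_. h) n * real n powr - s) has_sum
           (\<Prod>p\<in>P. \<Sum>a. h a * (real p powr - s) ^ a)) {n. n > 0 \<and> prime_factors n \<subseteq> P}"
proof -
  have *: "((\<lambda>a. h a * (real p powr - s) ^ a) has_sum (\<Sum>a. h a * (real p powr - s) ^ a)) UNIV"
    if "p \<in> P" for p
  proof (rule norm_summable_imp_has_sum)
    have "real p > 1" using assms that prime_gt_1_nat by force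
    then have "real p powr - s < 1" using \<open>s > 0\<close> by (simp add: powr_less_one)
    from summ[OF _ this] show "summable (\<lambda>a. norm (h a * (real p powr - s) ^ a))"
      by (simp add: abs_mult)
    then show "(\<lambda>a. h a * (real p powr - s) ^ a) sums (\<Sum>a. h a * (real p powr - s) ^ a)"
      by (rule summable_norm_cancel[THEN summable_sums])
  qed
  have "(mult_ext (\<lambda>p a. h a * (real p powr - s) ^ a) has_sum
          (\<Prod>p\<in>P. infsum (\<lambda>a. h a * (real p powr - s) ^ a) UNIV)) {n. n > 0 \<and> prime_factors n \<subseteq> P}"
    by (rule has_sum_mult_ext_finite_primes) (use assms * in \<open>auto simp: summable_on_def\<close>)
  also have "(\<Prod>p\<in>P. infsum (\<lambda>a. h a * (real p powr - s) ^ a) UNIV) = (\<Prod>p\<in>P. \<Sum>a. h a * (real p powr - s) ^ a)"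
    by (intro prod.cong refl infsumI *)
  finally show ?thesis
    by (subst (asm) has_sum_cong[OF mult_ext_powr_weight]) auto
qed

text \<open>All local arguments lie below \<open>2 powr - s\<close> < 1, so one constant in the
  quadratic bound serves every prime.\<close>

lemma prime_powr_neg_le:
  assumes "prime (p::nat)" "s > 0"
  shows "real p powr - s \<le> 2 powr - s" 
  using assms prime_ge_2_nat[of p] by (intro powr_mono2') auto

text \<open>With nonnegative terms it is enough to bound all finite sums uniformly. A finite set F
  is covered by the integers composed of the primes dividing its members, so the sum is at most a
  finite product of factors 1 + C p^(-2s), hence at most the exponential of C times the sum of
  n^(-2s), which converges as 2s > 1.\<close>

lemma summable_on_mult_ext_powr:
  fixes h :: "nat \<Rightarrow> real"
  assumes h: "h 0 = 1" "h (Suc 0) = 0"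
    and summ: "\<And>z. 0 \<le> z \<Longrightarrow> z < 1 \<Longrightarrow> summable (\<lambda>a. \<bar>h a\<bar> * z ^ a)"
    and s: "s > 1 / 2"
  shows "(\<lambda>n. \<bar>mult_ext (\<lambda>_. h) n\<bar> * real n powr - s) summable_on {0<..}"
proof (rule nonneg_bdd_above_summable_on)
  have "s > 0" using s by simp
  then have "(2::real) powr - s < 1" by (simp add: powr_less_one)
  then obtain C where C: "C \<ge> 0" and bound: "\<And>z. 0 \<le> z \<Longrightarrow> z \<le> 2 powr - s \<Longrightarrow> (\<Sum>a. \<bar>h a\<bar> * z ^ a) \<le> 1 + C * z\<^sup>2"
    using power_series_quadratic_bound[OF h summ, of "2 powr - s"] unfolding atLeastAtMost_iff by fastforce
  define Z where "Z = (\<Sum>n. real n powr (- 2 * s))"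
  have Z: "summable (\<lambda>n. real n powr (- 2 * s))" using s by (simp add: summable_real_powr_iff)
  show "bdd_above (sum (\<lambda>n. \<bar>mult_ext (\<lambda>_. h) n\<bar> * real n powr - s) ` {F. F \<subseteq> {0<..} \<and> finite F})"
  proof (rule bdd_aboveI2)
    fix F :: "nat set" assume "F \<in> {F. F \<subseteq> {0<..} \<and> finite F}"
    then have F: "F \<subseteq> {0<..}" "finite F" by auto
    define P where "P = (\<Union>n\<in>F. prime_factors n)"
    have P: "finite P" "\<And>p. p \<in> P \<Longrightarrow> prime p" unfolding P_def using F by auto
    \<comment> \<open>The finite Euler product is applied to |h|, which is legitimate because
      absolute values pass through \<open>mult_ext\<close>.\<close>
    have "((\<lambda>n. mult_ext (\<lambda>_ a. \<bar>h a\<bar>) n * real n powr - s) has_sum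
           (\<Prod>p\<in>P. \<Sum>a. \<bar>h a\<bar> * (real p powr - s) ^ a)) {n. n > 0 \<and> prime_factors n \<subseteq> P}"
      by (rule has_sum_mult_ext_power_series) (use h summ P \<open>s > 0\<close> in auto)
    then have hs: "((\<lambda>n. \<bar>mult_ext (\<lambda>_. h) n\<bar> * real n powr - s) has_sum
           (\<Prod>p\<in>P. \<Sum>a. \<bar>h a\<bar> * (real p powr - s) ^ a)) {n. n > 0 \<and> prime_factors n \<subseteq> P}"
      by (simp add: mult_ext_abs)
    have "(\<Sum>n\<in>F. \<bar>mult_ext (\<lambda>_. h) n\<bar> * real n powr - s) \<le> (\<Prod>p\<in>P. \<Sum>a. \<bar>h a\<bar> * (real p powr - s) ^ a)"
      by (rule has_sum_mono2[OF has_sum_finite hs]) (use F in \<open>auto simp: P_def\<close>)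
    also have "\<dots> \<le> (\<Prod>p\<in>P. 1 + C * real p powr (- 2 * s))"
    proof (intro prod_mono conjI)
      fix p assume p: "p \<in> P"
      have "(real p powr - s)\<^sup>2 = real p powr (- 2 * s)"
        using P p by (simp add: power2_eq_square powr_add[symmetric])
      then show "(\<Sum>a. \<bar>h a\<bar> * (real p powr - s) ^ a) \<le> 1 + C * real p powr (- 2 * s)"
        using bound[OF _ prime_powr_neg_le[OF P(2)[OF p] \<open>s > 0\<close>]] by simp
      have "real p powr - s < 1" using prime_powr_neg_le[OF P(2)[OF p] \<open>s > 0\<close>] \<open>2 powr - s < 1\<close> by linarith
      then show "0 \<le> (\<Sum>a. \<bar>h a\<bar> * (real p powr - s) ^ a)"
        using summ by (intro suminf_nonneg) auto
    qed
    also have "\<dots> \<le> exp (\<Sum>p\<in>P. C * real p powr (- 2 * s))"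
      by (rule prod_le_exp_sum) (use C in auto)
    also have "\<dots> \<le> exp (C * Z)"
      unfolding sum_distrib_left[symmetric] exp_le_cancel_iff Z_def using C P Z
      by (intro mult_left_mono sum_le_suminf) auto
    finally show "(\<Sum>n\<in>F. \<bar>mult_ext (\<lambda>_. h) n\<bar> * real n powr - s) \<le> exp (C * Z)" .
  qed
qed auto

text \<open>The product up to N is the sum over integers with all prime factors at most N. It
  differs from the full sum by terms with n > N only, hence by at most a tail of the absolutely
  convergent series.\<close>

lemma LIMSEQ_prime_part_prod:
  fixes h :: "nat \<Rightarrow> real"
  assumes h: "h 0 = 1"
    and summ: "\<And>z. 0 \<le> z \<Longrightarrow> z < 1 \<Longrightarrow> summable (\<lambda>a. \<bar>h a\<bar> * z ^ a)"
    and "s > 0"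
    and abs: "(\<lambda>n. \<bar>mult_ext (\<lambda>_. h) n\<bar> * real n powr - s) summable_on {0<..}"
  shows "(\<lambda>N. \<Prod>p\<le>N. prime_part (\<lambda>p. \<Sum>a. h a * (real p powr - s) ^ a) p)
           \<longlonglongrightarrow> (\<Sum>\<^sub>\<infinity>n\<in>{0<..}. mult_ext (\<lambda>_. h) n * real n powr - s)"
proof -
  define f where "f n = mult_ext (\<lambda>_. h) n * real n powr - s" for n
  define L where "L p = (\<Sum>a. h a * (real p powr - s) ^ a)" for p :: nat
  define G where "G = infsum f {0<..}"
  define T where "T = (\<Sum>\<^sub>\<infinity>n\<in>{0<..}. \<bar>f n\<bar>)"
  have abs_f: "(\<lambda>n. \<bar>f n\<bar>) summable_on {0<..}" using abs by (simp add: f_def abs_mult)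
  then have f: "f summable_on {0<..}"
    using summable_on_iff_abs_summable_on_real[of f] by (simp only: real_norm_def)
  have T: "((\<lambda>n. \<bar>f n\<bar>) has_sum T) {0<..}" unfolding T_def using abs_f by simp
  have bound: "\<bar>(\<Prod>p\<le>N. prime_part L p) - G\<bar> \<le> T - (\<Sum>n\<in>{0<..N}. \<bar>f n\<bar>)" for N
  proof -
    define P where "P = {p. prime p \<and> p \<le> N}"
    define A where "A = {n. n > 0 \<and> prime_factors n \<subseteq> P}"
    have "finite P" unfolding P_def by (rule finite_subset[of _ "{..N}"]) auto
    have "(\<Prod>p\<le>N. prime_part L p) = (\<Prod>p\<in>P. L p)"
      by (rule prod.mono_neutral_cong_right) (auto simp: P_def prime_part_def)
    moreover have "(f has_sum (\<Prod>p\<in>P. L p)) A"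
      unfolding f_def L_def A_def using \<open>finite P\<close>
      by (intro has_sum_mult_ext_power_series) (use assms in \<open>auto simp: P_def\<close>)
    ultimately have 1: "(f has_sum (\<Prod>p\<le>N. prime_part L p)) A" by simp
    have "(f has_sum G - (\<Prod>p\<le>N. prime_part L p)) ({0<..} - A)"
      by (rule has_sum_Diff) (use f 1 in \<open>auto simp: G_def A_def\<close>)
    moreover have 2: "((\<lambda>n. \<bar>f n\<bar>) has_sum T - (\<Sum>n\<in>{0<..N}. \<bar>f n\<bar>)) ({0<..} - {0<..N})"
      by (rule has_sum_Diff[OF T has_sum_finite]) auto
    \<comment> \<open>An integer outside A has a prime factor above N and so exceeds N
      itself.\<close>
    have sub: "{0<..} - A \<subseteq> {0<..} - {0<..N}"
      by (auto simp: A_def P_def in_prime_factors_iff dest!: dvd_imp_le)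
    obtain U where U: "((\<lambda>n. \<bar>f n\<bar>) has_sum U) ({0<..} - A)"
      using summable_on_subset_banach[OF abs_f, of "{0<..} - A"] by (auto simp: summable_on_def)
    have "U \<le> T - (\<Sum>n\<in>{0<..N}. \<bar>f n\<bar>)"
      by (rule has_sum_mono2[OF U 2 sub]) auto
    moreover have "\<bar>G - (\<Prod>p\<le>N. prime_part L p)\<bar> \<le> U"
      using norm_infsum_le[OF calculation(1) U] by simp
    ultimately show ?thesis by linarith
  qed
  have "((\<lambda>n. if n = 0 then 0 else \<bar>f n\<bar>) has_sum T) UNIV"
    by (rule iffD1[OF has_sum_cong_neutral T]) auto
  then have "(\<lambda>N. \<Sum>n\<le>N. if n = 0 then 0 else \<bar>f n\<bar>) \<longlonglongrightarrow> T"
    by (intro has_sum_imp_sums[unfolded sums_def_le])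
  also have "(\<lambda>N. \<Sum>n\<le>N. if n = 0 then 0 else \<bar>f n\<bar>) = (\<lambda>N. \<Sum>n\<in>{0<..N}. \<bar>f n\<bar>)"
    by (intro ext sum.mono_neutral_cong_right) auto
  finally have "(\<lambda>N. T - (\<Sum>n\<in>{0<..N}. \<bar>f n\<bar>)) \<longlonglongrightarrow> 0"
    using tendsto_diff[OF tendsto_const[of T]] by force
  then have "(\<lambda>N. (\<Prod>p\<le>N. prime_part L p) - G) \<longlonglongrightarrow> 0"
    by (rule Lim_null_comparison[rotated]) (use bound in auto)
  then show ?thesis
    unfolding G_def f_def L_def by (simp add: LIM_zero_iff)
qed

subsection \<open>Powers of the divisor function\<close>

lemma summable_local_series:
  assumes "prime p"
  shows "summable (\<lambda>\<alpha>. (real \<alpha> + 1) ^ r / real p ^ \<alpha>)"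
proof -
  have "\<bar>1 / real p\<bar> < 1" using prime_gt_1_nat[OF assms] by simp
  from summable_Suc_power_times_power[OF this, of r] show ?thesis by (simp add: power_divide)
qed

text \<open>The coefficients of \<open>(1 - X) ^ 2 ^ r * (\<Sum>a. (a + 1) ^ r * X ^ a)\<close>; the exponent is chosen
  to make the linear coefficient vanish.\<close>

definition tau_diff :: "nat \<Rightarrow> nat \<Rightarrow> real" where
  "tau_diff r = (bdiff ^^ (2 ^ r)) (\<lambda>a. (real a + 1) ^ r)"

lemma tau_diff_0: "tau_diff r 0 = 1"
  by (simp add: tau_diff_def)

lemma tau_diff_1: "tau_diff r (Suc 0) = 0"
  unfolding tau_diff_def funpow_bdiff_1 by simp

text \<open>The 2^r differences enlarge the monotone weight (a + 1)^r by at most 2^(2^r), so the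
  radius of convergence stays at least 1.\<close>

lemma summable_abs_tau_diff:
  assumes "0 \<le> z" "z < 1" 
  shows "summable (\<lambda>a. \<bar>tau_diff r a\<bar> * z ^ a)"
proof (rule summable_comparison_test')
  define c :: real where "c = 2 ^ (2 ^ r)"
  show "summable (\<lambda>a. c * ((real a + 1) ^ r * z ^ a))"
    using assms by (intro summable_mult summable_Suc_power_times_power) auto
  have mono: "mono (\<lambda>a. (real a + 1) ^ r)"
    by (intro monoI power_mono) auto
  fix a
  have "\<bar>tau_diff r a\<bar> \<le> c * (real a + 1) ^ r"
    unfolding tau_diff_def c_def using mono by (rule abs_funpow_bdiff_le) simp
  then have "\<bar>tau_diff r a\<bar> * z ^ a \<le> c * (real a + 1) ^ r * z ^ a"
    using assms by (intro mult_right_mono) auto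
  then show "norm (\<bar>tau_diff r a\<bar> * z ^ a) \<le> c * ((real a + 1) ^ r * z ^ a)"
    using assms by (simp add: abs_mult mult.assoc)
qed

lemma suminf_tau_diff:
  assumes "prime p"
  shows "(\<Sum>a. tau_diff r a * (real p powr - 1) ^ a) = euler_factor r p"
proof -
  have "real p powr - 1 = 1 / real p" by (simp add: powr_minus_divide)
  have "(\<lambda>a. (real a + 1) ^ r * (1 / real p) ^ a) sums (\<Sum>\<alpha>. (real \<alpha> + 1) ^ r / real p ^ \<alpha>)"
    using summable_sums[OF summable_local_series[OF assms, of r]] by (simp add: power_divide)
  from bdiff_power_series_sums[OF this, of "2 ^ r"] show ?thesis
    unfolding \<open>real p powr - 1 = 1 / real p\<close> tau_diff_def euler_factor_def by (rule sums_unique[symmetric])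
qed

text \<open>At z = 1/p <= 1/2 the quadratic bound shows that the Euler factor is 1 + O(p^(-2)), so
  the product converges absolutely.\<close>

lemma convergent_prod_euler_factor: "convergent_prod (prime_part (euler_factor r))"
proof -
  obtain C where "C \<ge> 0"
    and C: "\<And>z. 0 \<le> z \<Longrightarrow> z \<le> 1 / 2 \<Longrightarrow> \<bar>(\<Sum>a. tau_diff r a * z ^ a) - 1\<bar> \<le> C * z\<^sup>2"
    using power_series_quadratic_bound[OF tau_diff_0 tau_diff_1 summable_abs_tau_diff, of "1 / 2"] by fastforce
  have "summable (\<lambda>p. norm (prime_part (euler_factor r) p - 1))"
  proof (rule summable_comparison_test')
    show "summable (\<lambda>p. C * real p powr - 2)"
      by (intro summable_mult) (simp add: summable_real_powr_iff)
    fix p :: nat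
    show "norm (norm (prime_part (euler_factor r) p - 1)) \<le> C * real p powr - 2"
    proof (cases "prime p")
      case True
      have "real p powr - 1 \<le> 1 / 2"
        using prime_powr_neg_le[OF True, of 1] by (simp add: powr_minus_divide)
      from C[OF _ this] have "\<bar>euler_factor r p - 1\<bar> \<le> C * (real p powr - 1)\<^sup>2"
        unfolding suminf_tau_diff[OF True] by simp
      also have "(real p powr - 1)\<^sup>2 = real p powr - 2"
        unfolding power2_eq_square powr_add[symmetric] by simp
      finally show ?thesis using True by (simp add: prime_part_def)
    qed (use \<open>C \<ge> 0\<close> in \<open>simp add: prime_part_def\<close>)
  qed
  then have "abs_convergent_prod (prime_part (euler_factor r))"
    by (simp add: abs_convergent_prod_conv_summable)
  then show ?thesis by (rule abs_convergent_prod_imp_convergent_prod)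
qed

lemma summable_on_mult_ext_tau_diff:
  "s > 1 / 2 \<Longrightarrow> (\<lambda>n. \<bar>mult_ext (\<lambda>_. tau_diff r) n\<bar> * real n powr - s) summable_on {0<..}"
  by (rule summable_on_mult_ext_powr[OF tau_diff_0 tau_diff_1 summable_abs_tau_diff])

text \<open>The partial products tend both to the sum of g(n)/n and to \<open>prodinf\<close>;
  uniqueness of limits identifies the two.\<close>

lemma has_sum_mult_ext_tau_diff:
  "((\<lambda>n. mult_ext (\<lambda>_. tau_diff r) n / real n) has_sum prodinf (prime_part (euler_factor r))) {0<..}"
proof -
  define f where "f n = mult_ext (\<lambda>_. tau_diff r) n * real n powr - 1" for n
  have s: "(\<lambda>n. \<bar>f n\<bar>) summable_on {0<..}"
    using summable_on_mult_ext_tau_diff[of 1 r] by (simp add: f_def abs_mult)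
  have "prime_part (\<lambda>p. \<Sum>a. tau_diff r a * (real p powr - 1) ^ a) = prime_part (euler_factor r)"
    unfolding prime_part_def using suminf_tau_diff by auto
  then have "(\<lambda>N. \<Prod>p\<le>N. prime_part (euler_factor r) p) \<longlonglongrightarrow> infsum f {0<..}"
    using LIMSEQ_prime_part_prod[OF tau_diff_0 summable_abs_tau_diff _ summable_on_mult_ext_tau_diff[of 1 r]]
    by (simp add: f_def[abs_def])
  then have "infsum f {0<..} = prodinf (prime_part (euler_factor r))"
    using convergent_prod_LIMSEQ[OF convergent_prod_euler_factor] LIMSEQ_unique by blast
  moreover have "f summable_on {0<..}"
    using s summable_on_iff_abs_summable_on_real[of f] by simp
  ultimately have "(f has_sum prodinf (prime_part (euler_factor r))) {0<..}"
    using has_sum_infsum by metis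
  also have "?this \<longleftrightarrow> ?thesis"
    by (rule has_sum_cong) (simp add: f_def powr_minus_divide)
  finally show ?thesis .
qed

text \<open>The first two conjuncts certify that the series and the product inside
  \<open>C_const\<close> converge, so that \<open>suminf\<close> and \<open>prodinf\<close> denote
  their actual values.\<close>

theorem mainTheorem2:
  fixes r :: nat
  assumes "r \<ge> 2"
  shows "(\<forall>p::nat. prime p \<longrightarrow> summable (\<lambda>\<alpha>. (real \<alpha> + 1) ^ r / real p ^ \<alpha>)) \<and>
         convergent_prod (prime_part (euler_factor r)) \<and>
         (\<exists>K::real. \<forall>x::real. x \<ge> 2 \<longrightarrow>
            \<bar>(\<Sum>n | 0 < n \<and> real n \<le> x. real (divisor_tau n) ^ r)
              - C_const r * x * ln x ^ (2 ^ r - 1)\<bar>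
            \<le> K * (x * ln x ^ (2 ^ r - 2)))"
proof (intro conjI)
  define k :: nat where "k = 2 ^ r"
  define i where "i = k - 2"
  have "k \<ge> 2 ^ 2" unfolding k_def using assms by (intro power_increasing) auto
  then have k: "k = i + 2" by (simp add: i_def)
  define G where "G = prodinf (prime_part (euler_factor r))"
  \<comment> \<open>F interpolates between g at j = 0 and tau^r at j = k, since k partial sums undo
    the k differences in \<open>tau_diff\<close>.\<close>
  define F where "F j n = mult_ext (\<lambda>_. (psum ^^ j) (tau_diff r)) n" for j n
  have F_Suc: "F (Suc j) n = (\<Sum>d | d dvd n. F j d)" if "n > 0" for j n
  proof -
    have "F (Suc j) n = mult_ext (\<lambda>_ a. \<Sum>l\<le>a. (psum ^^ j) (tau_diff r) l) n"
      by (simp add: F_def psum_def[abs_def])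
    also have "\<dots> = (\<Sum>d | d dvd n. F j d)"
      unfolding F_def using that
      by (intro sum_divisors_mult_ext[symmetric]) (simp_all add: funpow_psum_0 tau_diff_0)
    finally show ?thesis .
  qed
  have F_k: "F k n = real (divisor_tau n) ^ r" if "n > 0" for n
    unfolding F_def tau_diff_def k_def funpow_psum_bdiff
    by (simp add: mult_ext_power divisor_tau_mult_ext[OF that])
  have "\<exists>K. \<forall>x\<ge>1. \<bar>(\<Sum>n\<in>upto_nats x. F (i + 2) n) - G * x * ln x ^ (i + 1) / fact (i + 1)\<bar> \<le> K * x * (1 + ln x) ^ i"
  proof (rule iterated_sum_divisors_asymp)
    \<comment> \<open>Any exponent strictly between 1/2 (absolute convergence) and 1 (a saving over
      x) would do; 3/4 is the midpoint.\<close>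
    show "((\<lambda>n. \<bar>F 0 n\<bar> * real n powr - (3 / 4)) has_sum
        (\<Sum>\<^sub>\<infinity>n\<in>{0<..}. \<bar>F 0 n\<bar> * real n powr - (3 / 4))) {0<..}"
      using summable_on_mult_ext_tau_diff[of "3 / 4" r] by (simp add: F_def)
    show "((\<lambda>n. F 0 n / real n) has_sum G) {0<..}"
      using has_sum_mult_ext_tau_diff[of r] by (simp add: F_def G_def)
  qed (simp_all add: F_Suc)
  then obtain K where K: "\<And>x. x \<ge> 1 \<Longrightarrow> \<bar>(\<Sum>n\<in>upto_nats x. F k n) - G * x * ln x ^ (i + 1) / fact (i + 1)\<bar> \<le> K * x * (1 + ln x) ^ i"
    unfolding k by blast
  have "K \<ge> 0" using K[of 1] by simp
  have i: "2 ^ r - 1 = i + 1" "2 ^ r - 2 = i" using k unfolding k_def by auto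
  show "\<exists>K::real. \<forall>x::real. x \<ge> 2 \<longrightarrow>
            \<bar>(\<Sum>n | 0 < n \<and> real n \<le> x. real (divisor_tau n) ^ r)
              - C_const r * x * ln x ^ (2 ^ r - 1)\<bar> \<le> K * (x * ln x ^ (2 ^ r - 2))"
  \<comment> \<open>For x >= 2 one has 1 <= ln x / ln 2, which turns 1 + ln x into a multiple of ln
    x.\<close>
  proof (intro exI[of _ "K * (1 / ln 2 + 1) ^ i"] allI impI)
    fix x :: real assume x: "x \<ge> 2"
    have "1 + ln x \<le> (1 / ln 2 + 1) * ln x" using x by (simp add: field_simps)
    then have "(1 + ln x) ^ i \<le> ((1 / ln 2 + 1) * ln x) ^ i"
      using x by (intro power_mono add_nonneg_nonneg) auto
    then have "K * x * (1 + ln x) ^ i \<le> K * x * ((1 / ln 2 + 1) * ln x) ^ i"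
      using x \<open>K \<ge> 0\<close> by (intro mult_left_mono) auto
    moreover have "(\<Sum>n\<in>upto_nats x. F k n) = (\<Sum>n | 0 < n \<and> real n \<le> x. real (divisor_tau n) ^ r)"
      unfolding upto_nats_def by (intro sum.cong refl) (simp add: F_k)
    moreover have "C_const r * x * ln x ^ (i + 1) = G * x * ln x ^ (i + 1) / fact (i + 1)"
      unfolding C_const_def i G_def by (simp del: fact_Suc)
    ultimately show "\<bar>(\<Sum>n | 0 < n \<and> real n \<le> x. real (divisor_tau n) ^ r)
              - C_const r * x * ln x ^ (2 ^ r - 1)\<bar> \<le> K * (1 / ln 2 + 1) ^ i * (x * ln x ^ (2 ^ r - 2))"
      unfolding i using K[of x] x by (simp add: power_mult_distrib mult_ac)
  qed
qed (use summable_local_series convergent_prod_euler_factor in auto)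

end
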